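(* Let $G$ be a finite simple undirected graph with no antitriangle that has exactly one coloring $\mathfrak{C}$ of size $\chi(G)$. Then for every transversal $T$ of $\mathfrak{C}$ there exists a shallow clique minor of $G$ of size $\chi(G)$ that is traversed by $T$.
   Context: An anticlique of $G$ is a set of pairwise nonadjacent vertices; an antitriangle is an anticlique of size $3$. A coloring of $G$ is a partition of $V(G)$ into (nonempty) anticliques; its size is the number of classes; $\chi(G)$ is the smallest size of a coloring of $G$. A subset of $V(G)$ is connected if it induces a connected subgraph; two subsets of $V(G)$ are adjacent if some edge of $G$ has one end in each. A clique minor of $G$ is a set of pairwise disjoint, pairwise adjacent, connected, nonempty subsets of $V(G)$; it is shallow if all its members have size $1$ or $2$. A transversal of a set $\mathfrak{S}$ of sets is a set $T$ with $|T \cap D| = 1$ for every $D \in \mathfrak{S}$; in that case $\mathfrak{S}$ is said to be traversed by $T$. *)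

theory Defs
  imports "Graph_Theory.Digraph_Component" "HOL-Library.Disjoint_Sets"
begin

text \<open>
  A finite simple undirected graph is \<^term>\<open>graph G\<close>: finite and loop-free, without parallel
  arcs, and with a symmetric arc relation, so that an undirected edge is a pair of opposite arcs.
\<close>

definition anticlique :: "('a, 'b) pre_digraph \<Rightarrow> 'a set \<Rightarrow> bool" where
  "anticlique G S \<longleftrightarrow> S \<subseteq> verts G \<and> pairwise (\<lambda>u v. \<not> (u \<rightarrow>\<^bsub>G\<^esub> v)) S"

definition antitriangle :: "('a, 'b) pre_digraph \<Rightarrow> 'a set \<Rightarrow> bool" where
  "antitriangle G S \<longleftrightarrow> anticlique G S \<and> card S = 3"

definition coloring :: "('a, 'b) pre_digraph \<Rightarrow> 'a set set \<Rightarrow> bool" where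
  "coloring G C \<longleftrightarrow> partition_on (verts G) C \<and> (\<forall>S\<in>C. anticlique G S)"

text \<open>
  For a graph with finitely many vertices and no loops, the partition into singletons is a
  coloring, so the minimum exists.
\<close>

definition chromatic_number :: "('a, 'b) pre_digraph \<Rightarrow> nat" where
  "chromatic_number G = (LEAST n. \<exists>C. coloring G C \<and> card C = n)"

definition connected_subset :: "('a, 'b) pre_digraph \<Rightarrow> 'a set \<Rightarrow> bool" where
  "connected_subset G S \<longleftrightarrow> S \<subseteq> verts G \<and> Digraph_Component.connected (G \<restriction> S)"

definition adjacent_subsets :: "('a, 'b) pre_digraph \<Rightarrow> 'a set \<Rightarrow> 'a set \<Rightarrow> bool" where
  "adjacent_subsets G S S' \<longleftrightarrow> (\<exists>u\<in>S. \<exists>v\<in>S'. u \<rightarrow>\<^bsub>G\<^esub> v)"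

text \<open>
  The members are subsets of the vertex set by connectedness, so over a finite graph a clique
  minor is a finite set and its size is its cardinality.
\<close>

definition clique_minor :: "('a, 'b) pre_digraph \<Rightarrow> 'a set set \<Rightarrow> bool" where
  "clique_minor G K \<longleftrightarrow>
     (\<forall>S\<in>K. S \<noteq> {} \<and> connected_subset G S) \<and> disjoint K \<and> pairwise (adjacent_subsets G) K"

definition shallow :: "'a set set \<Rightarrow> bool" where
  "shallow K \<longleftrightarrow> (\<forall>S\<in>K. card S = 1 \<or> card S = 2)"

definition transversal :: "'a set set \<Rightarrow> 'a set \<Rightarrow> bool" where
  "transversal \<SS> T \<longleftrightarrow> (\<forall>D\<in>\<SS>. card (T \<inter> D) = 1)"

end

theory Submission
  imports Defs
begin

text \<open>
  Without antitriangles every color class has at most two vertices. Let \<open>p i\<close> be the other vertex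
  in the class of \<open>i \<in> T\<close> (or \<open>i\<close> itself). An alternating cycle of color classes and
  non-edges \<open>i, p j\<close> would yield a second coloring, so every nonempty set \<open>J \<subseteq> T\<close> contains a
  source: some \<open>s\<close> such that \<open>p s\<close> is adjacent to all \<open>j \<in> J - {s}\<close>. If \<open>s\<close> has no
  non-neighbor in \<open>J\<close>, the branch set \<open>{s}\<close> can be added to the ones found for \<open>J - {s}\<close>.
  Otherwise let \<open>i\<close> be a source of the set of non-neighbors of \<open>s\<close> in \<open>J\<close>; then the two branch
  sets \<open>{s, p i}\<close> and \<open>{i, p s}\<close> can be added to the ones found for \<open>J - {s, i}\<close>.
\<close>

section \<open>Non-edges, and connected sets with at most two vertices\<close>

definition nonadjacent :: "('a, 'b) pre_digraph \<Rightarrow> 'a \<Rightarrow> 'a \<Rightarrow> bool" where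
  "nonadjacent G u v \<longleftrightarrow> u \<in> verts G \<and> v \<in> verts G \<and> u \<noteq> v \<and> \<not> (u \<rightarrow>\<^bsub>G\<^esub> v)"

lemma (in graph) dominates_sym: "u \<rightarrow>\<^bsub>G\<^esub> v \<Longrightarrow> v \<rightarrow>\<^bsub>G\<^esub> u"
  using arcs_ends_symmetric[OF sym_arcs] .

lemma (in graph) nonadjacent_sym: "nonadjacent G u v \<Longrightarrow> nonadjacent G v u"
  unfolding nonadjacent_def using dominates_sym[of v u] by blast

lemma (in graph) anticlique_pair:
  assumes "u \<in> verts G" "v \<in> verts G" "u = v \<or> nonadjacent G u v"
  shows "anticlique G {u, v}"
  using assms unfolding anticlique_def nonadjacent_def pairwise_def by (auto dest: dominates_sym)

lemma (in graph) connected_subset_singleton: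
  assumes "u \<in> verts G"
  shows "connected_subset G {u}"
proof -
  have "u \<rightarrow>\<^sup>*\<^bsub>mk_symmetric (G \<restriction> {u})\<^esub> u"
    by (simp add: reachable_def rtrancl_on.intros(1))
  then show ?thesis
    using assms unfolding connected_subset_def connected_def strongly_connected_def by simp
qed

lemma (in graph) connected_subset_pair:
  assumes "u \<rightarrow>\<^bsub>G\<^esub> v"
  shows "connected_subset G {u, v}"
proof -
  have uv: "u \<in> verts G" "v \<in> verts G"
    using assms by auto
  let ?H = "G \<restriction> {u, v}"
  interpret H: wf_digraph ?H by auto
  have "u \<rightarrow>\<^bsub>?H\<^esub> v" "v \<rightarrow>\<^bsub>?H\<^esub> u"
    using assms dominates_sym[of u v] unfolding arcs_ends_conv by (auto intro!: image_eqI)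
  then have "x \<rightarrow>\<^sup>*\<^bsub>?H\<^esub> y" if "x \<in> {u, v}" "y \<in> {u, v}" for x y
    using that by auto
  then show ?thesis
    using uv H.reachable_mk_symmetricI
    unfolding connected_subset_def connected_def strongly_connected_def by simp
qed

text \<open>Replacing \<open>J\<close> by its image under \<open>g\<close> shrinks it until it is
  stable, and a surjective self-map of a finite set is injective. The resulting \<open>K\<close> is
  a union of cycles of \<open>g\<close>.\<close>

lemma ex_bij_betw_subset:
  assumes "finite J" "g ` J \<subseteq> J" "J \<noteq> {}"
  shows "\<exists>K\<subseteq>J. K \<noteq> {} \<and> bij_betw g K K"
  using assms
proof (induction J rule: finite_psubset_induct)
  case (psubset J)
  show ?case
  proof (cases "g ` J = J")
    case True
    then have "bij_betw g J J"
      using eq_card_imp_inj_on[OF psubset.hyps, of g] by (simp add: bij_betw_def)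
    then show ?thesis using psubset.prems by blast
  next
    case False
    then show ?thesis
      using psubset.IH[of "g ` J"] psubset.prems by (meson image_is_empty image_mono psubsetI subset_trans)
  qed
qed

section \<open>The unique optimal coloring, encoded by a partner map\<close>

text \<open>The classes are the sets \<open>{i, p i}\<close>, with \<open>p i = i\<close> for
  singletons. In \<open>rigid\<close> the members of the family \<open>F\<close> may coincide, so it
  speaks of colorings with at most \<open>card I\<close> classes. This merges minimality with
  uniqueness, and a recoloring never has to be shown injective in its index.\<close>

locale rigid_partner = graph G for G :: "('a, 'b) pre_digraph" +
  fixes I :: "'a set" and p :: "'a \<Rightarrow> 'a"
  assumes no_antitriangle: "\<not> (\<exists>S. antitriangle G S)"
    and verts_eq: "verts G = I \<union> p ` I"
    and inj_partner: "inj_on p I"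
    and partner_notin: "i \<in> I \<Longrightarrow> p i \<in> I \<Longrightarrow> p i = i"
    and partner_nonadjacent: "i \<in> I \<Longrightarrow> p i \<noteq> i \<Longrightarrow> nonadjacent G i (p i)"
    and rigid: "\<lbrakk>\<Union>(F ` I) = verts G;
        \<And>s t. s \<in> I \<Longrightarrow> t \<in> I \<Longrightarrow> F s = F t \<or> F s \<inter> F t = {};
        \<And>s. s \<in> I \<Longrightarrow> F s \<noteq> {} \<and> anticlique G (F s)\<rbrakk>
      \<Longrightarrow> F ` I = (\<lambda>s. {s, p s}) ` I"
begin

abbreviation h :: "'a \<Rightarrow> 'a \<Rightarrow> bool" where "h \<equiv> nonadjacent G"

lemma finite_I: "finite I"
  using verts_eq finite_verts by (metis finite_Un)

lemma in_verts: "i \<in> I \<Longrightarrow> i \<in> verts G" "i \<in> I \<Longrightarrow> p i \<in> verts G"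
  using verts_eq by auto

lemma no_triangle: "h x y \<Longrightarrow> h y z \<Longrightarrow> h x z \<Longrightarrow> False"
proof -
  assume "h x y" "h y z" "h x z"
  then have "anticlique G {x, y, z}" "card {x, y, z} = 3"
    unfolding anticlique_def nonadjacent_def pairwise_def by (auto dest: dominates_sym)
  then show False
    using no_antitriangle unfolding antitriangle_def by blast
qed

lemma anticlique_partner: "i \<in> I \<Longrightarrow> anticlique G {i, p i}"
  using in_verts partner_nonadjacent by (intro anticlique_pair) metis+

section \<open>Adjacencies forced by the absence of rival colorings\<close>

text \<open>By \<open>rigid\<close> the class \<open>F s\<close> is some \<open>{t, p t}\<close>.
  Since \<open>p t\<close> lies in \<open>I\<close> only if it equals \<open>t\<close>, the element
  \<open>i\<close> must be \<open>t\<close>. Each recoloring below is refuted by a class that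
  violates one of these inclusions.\<close>

lemma rigid_classes:
  assumes "\<Union>(F ` I) = verts G"
    and "\<And>s t. s \<in> I \<Longrightarrow> t \<in> I \<Longrightarrow> F s = F t \<or> F s \<inter> F t = {}"
    and "\<And>s. s \<in> I \<Longrightarrow> F s \<noteq> {} \<and> anticlique G (F s)"
    and "s \<in> I" "i \<in> I" "i \<in> F s"
  shows "F s \<inter> I \<subseteq> {i}" and "F s \<subseteq> {i, p i}"
proof -
  obtain t where t: "t \<in> I" "F s = {t, p t}"
    using rigid[OF assms(1-3)] assms(4) by blast
  then show "F s \<inter> I \<subseteq> {i}" "F s \<subseteq> {i, p i}"
    using partner_notin[of t] assms(5,6) by auto
qed

lemma partner_distinct:
  assumes "i \<in> I" "j \<in> I" "i \<noteq> j"
  shows "p i \<noteq> p j" "p i \<noteq> j" "j \<noteq> p i"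
  using assms partner_notin[of i] inj_partner by (auto dest: inj_onD)

text \<open>If \<open>{i}\<close> is a class, a non-neighbor \<open>j\<close> of \<open>i\<close>
  could move into it without increasing the number of classes.\<close>

lemma singleton_class_not_nonadjacent:
  assumes "i \<in> I" "j \<in> I" "p i = i"
  shows "\<not> h i j"
proof
  assume ij: "h i j"
  then have "i \<noteq> j" by (auto simp: nonadjacent_def)
  \<comment> \<open>Here \<open>j\<close> joins \<open>i\<close> and \<open>p j\<close> stays behind
    alone. If \<open>p j = j\<close>, nothing stays behind; as members of the family must be
    nonempty, index \<open>j\<close> then repeats \<open>{i, j}\<close>.\<close>
  define F where "F = (\<lambda>s. if s = i then {i, j} else if s = j
    then (if p j = j then {i, j} else {p j}) else {s, p s})"
  have U: "\<Union>(F ` I) = verts G"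
  proof
    show "\<Union>(F ` I) \<subseteq> verts G"
      using assms in_verts by (auto simp: F_def split: if_splits)
    show "verts G \<subseteq> \<Union>(F ` I)"
    proof
      fix v assume "v \<in> verts G"
      then consider s where "s \<in> I" "v = s" | s where "s \<in> I" "v = p s"
        using verts_eq by auto
      then show "v \<in> \<Union>(F ` I)"
      proof cases
        case 1
        then have "v \<in> F (if s = j then i else s)" by (simp add: F_def)
        then show ?thesis using 1 assms by auto
      next
        case 2
        then have "v \<in> F s" using assms \<open>i \<noteq> j\<close> by (auto simp: F_def)
        then show ?thesis using 2 by auto
      qed
    qed
  qed
  have D: "F s = F t \<or> F s \<inter> F t = {}" if "s \<in> I" "t \<in> I" for s t
    using that assms \<open>i \<noteq> j\<close>
    by (cases "s = t") (auto simp: F_def partner_distinct)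
  have A: "F s \<noteq> {} \<and> anticlique G (F s)" if "s \<in> I" for s
    using that assms ij in_verts anticlique_partner anticlique_pair[of i j]
      anticlique_pair[of "p j" "p j"]
    by (simp add: F_def)
  have "F i = {i, j}" by (simp add: F_def)
  then show False
    using rigid_classes(1)[OF U D A assms(1) assms(1)] assms \<open>i \<noteq> j\<close> by auto
qed

text \<open>Otherwise the two classes could be regrouped as \<open>{i, j}\<close> and
  \<open>{p i, p j}\<close>.\<close>

lemma partner_adjacent:
  assumes "i \<in> I" "j \<in> I" "h i j"
  shows "\<not> h (p i) (p j)"
proof
  assume p: "h (p i) (p j)"
  have "i \<noteq> j" using assms by (auto simp: nonadjacent_def)
  define F where "F = (\<lambda>s. if s = i then {i, j} else if s = j then {p i, p j} else {s, p s})"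
  have U: "\<Union>(F ` I) = verts G"
  proof
    show "\<Union>(F ` I) \<subseteq> verts G"
      using assms in_verts by (auto simp: F_def split: if_splits)
    show "verts G \<subseteq> \<Union>(F ` I)"
    proof
      fix v assume "v \<in> verts G"
      then consider s where "s \<in> I" "v = s" | s where "s \<in> I" "v = p s"
        using verts_eq by auto
      then show "v \<in> \<Union>(F ` I)"
      proof cases
        case 1
        then have "v \<in> F (if s = j then i else s)" by (simp add: F_def)
        then show ?thesis using 1 assms by auto
      next
        case 2
        then have "v \<in> F (if s = i then j else s)" using \<open>i \<noteq> j\<close> by (simp add: F_def)
        then show ?thesis using 2 assms by auto
      qed
    qed
  qed
  \<comment> \<open>A singleton class would make the two regrouped sets overlap.\<close>
  have ne: "p i \<noteq> i" "p j \<noteq> j"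
    using assms singleton_class_not_nonadjacent nonadjacent_sym by blast+
  have D: "F s = F t \<or> F s \<inter> F t = {}" if "s \<in> I" "t \<in> I" for s t
    using that assms \<open>i \<noteq> j\<close> ne
    by (cases "s = t") (auto simp: F_def partner_distinct)
  have A: "F s \<noteq> {} \<and> anticlique G (F s)" if "s \<in> I" for s
    using that assms p in_verts anticlique_partner anticlique_pair[of i j]
      anticlique_pair[of "p i" "p j"]
    by (simp add: F_def)
  have "F i = {i, j}" by (simp add: F_def)
  then show False
    using rigid_classes(1)[OF U D A assms(1) assms(1)] assms \<open>i \<noteq> j\<close> by auto
qed

text \<open>If there is no source, choose for each \<open>s\<close> some other \<open>g s\<close> in
  \<open>J\<close> that is nonadjacent to \<open>p s\<close>. Along the cycles of \<open>g\<close>,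
  pairing \<open>p s\<close> with \<open>g s\<close> instead of \<open>s\<close> gives a rival
  coloring.\<close>

lemma source_exists:
  assumes "J \<subseteq> I" "J \<noteq> {}"
  shows "\<exists>s\<in>J. \<forall>j\<in>J. j \<noteq> s \<longrightarrow> \<not> h j (p s)"
proof (rule ccontr)
  assume "\<not> ?thesis"
  then obtain g where g: "g s \<in> J" "g s \<noteq> s" "h (g s) (p s)" if "s \<in> J" for s
    by metis
  \<comment> \<open>If \<open>p s = s\<close>, then \<open>g s\<close> would be a non-neighbor of a
    singleton class.\<close>
  have ne: "p s \<noteq> s" if "s \<in> J" for s
    using g[OF that] that assms singleton_class_not_nonadjacent[of s "g s"] nonadjacent_sym
    by (metis subsetD)
  obtain K where K: "K \<subseteq> J" "K \<noteq> {}" "bij_betw g K K"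
    using ex_bij_betw_subset[of J g] g(1) assms finite_I finite_subset by blast
  have gK: "g ` K = K" "inj_on g K"
    using K(3) by (auto simp: bij_betw_def)
  have g_K: "g s \<in> K" if "s \<in> K" for s
    using imageI[OF that, of g] gK(1) by simp
  \<comment> \<open>The rotation along the cycles in \<open>K\<close>, extended by the identity to a
    permutation of \<open>I\<close>.\<close>
  define \<pi> where "\<pi> s = (if s \<in> K then g s else s)" for s
  have KI: "K \<subseteq> I" using K assms by auto
  have \<pi>_I: "\<pi> s \<in> I" if "s \<in> I" for s
    using subsetD[OF KI g_K[of s]] that by (simp add: \<pi>_def)
  have \<pi>_img: "\<pi> ` I = I"
  proof
    have "x \<in> \<pi> ` I" if "x \<in> I" for x
    proof (cases "x \<in> K")
      case True
      then obtain y where "y \<in> K" "x = g y" using gK by auto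
      then show ?thesis using KI by (auto simp: \<pi>_def intro!: image_eqI[of _ _ y])
    next
      case False
      then show ?thesis using that by (auto simp: \<pi>_def intro!: image_eqI[of _ _ x])
    qed
    then show "I \<subseteq> \<pi> ` I" by auto
  qed (use \<pi>_I in auto)
  have \<pi>_inj: "\<pi> s = \<pi> t \<longleftrightarrow> s = t" if "s \<in> I" "t \<in> I" for s t
    using eq_card_imp_inj_on[OF finite_I, of \<pi>] \<pi>_img that by (auto dest: inj_onD)
  define F where "F s = {\<pi> s, p s}" for s
  have U: "\<Union>(F ` I) = verts G"
    using \<pi>_img verts_eq unfolding F_def by auto
  \<comment> \<open>A coincidence puts \<open>p t\<close> into \<open>I\<close>, so
    \<open>{t}\<close> is a singleton class. Then \<open>t\<close> lies outside \<open>K\<close> and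
    is fixed by \<open>\<pi>\<close>, and injectivity of \<open>\<pi>\<close> identifies
    \<open>s\<close> with \<open>t\<close>.\<close>
  have \<pi>_p: "s = t" if "\<pi> s = p t" "s \<in> I" "t \<in> I" for s t
  proof -
    have "p t = t" using that \<pi>_I partner_notin by metis
    then have "\<pi> t = t" using ne subsetD[OF K(1)] by (metis \<pi>_def)
    then show ?thesis using that \<pi>_inj \<open>p t = t\<close> by metis
  qed
  have D: "F s = F t \<or> F s \<inter> F t = {}" if "s \<in> I" "t \<in> I" for s t
  proof (cases "s = t")
    case False
    then have "\<pi> s \<noteq> \<pi> t" "\<pi> s \<noteq> p t" "p s \<noteq> \<pi> t" "p s \<noteq> p t"
      using that \<pi>_inj \<pi>_p[of s t] \<pi>_p[of t s] partner_distinct(1) by metis+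
    then show ?thesis by (simp add: F_def)
  qed simp
  have A: "F s \<noteq> {} \<and> anticlique G (F s)" if s: "s \<in> I" for s
  proof -
    have "\<pi> s = p s \<or> h (\<pi> s) (p s)"
    proof (cases "s \<in> K")
      case True
      then show ?thesis using g(3)[OF subsetD[OF K(1) True]] by (simp add: \<pi>_def)
    next
      case False
      then show ?thesis using partner_nonadjacent[OF s] by (cases "p s = s") (simp_all add: \<pi>_def)
    qed
    then show ?thesis
      using anticlique_pair in_verts \<pi>_I s unfolding F_def by blast
  qed
  \<comment> \<open>For \<open>s\<close> in \<open>K\<close> the new class \<open>{g s, p s}\<close>
    mixes two different old classes, which contradicts rigidity.\<close>
  obtain s where s: "s \<in> K" using K by auto
  have "g s \<in> F s" "p s \<in> F s" "g s \<in> I" "s \<in> I"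
    using s subsetD[OF KI] g_K by (simp_all add: F_def \<pi>_def)
  then have "p s \<in> {g s, p (g s)}"
    using rigid_classes(2)[OF U D A \<open>s \<in> I\<close>] by blast
  moreover have "g s \<noteq> s"
    using g(2)[OF subsetD[OF K(1) s]] .
  ultimately show False
    using partner_distinct[OF \<open>s \<in> I\<close> \<open>g s \<in> I\<close>] by simp
qed

section \<open>Inductive construction of the branch sets\<close>

text \<open>The relation \<open>h\<close> also fails for equal vertices, so
  \<open>\<not> h u v\<close> alone gives no edge. For sets of vertices, disjointness excludes
  \<open>u = v\<close> and turns it into one.\<close>

definition separated_adjacent :: "'a set \<Rightarrow> 'a set \<Rightarrow> bool" where
  "separated_adjacent A B \<longleftrightarrow> A \<inter> B = {} \<and> (\<exists>u\<in>A. \<exists>v\<in>B. \<not> h u v)"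

lemma separated_adjacent_sym: "separated_adjacent A B \<Longrightarrow> separated_adjacent B A"
  unfolding separated_adjacent_def using nonadjacent_sym by blast

text \<open>The shape records what the minor needs. The condition \<open>p j \<noteq> j\<close> puts
  the second vertex outside \<open>I\<close>, so that \<open>i\<close> is the only vertex of
  \<open>I\<close> in its branch set, and \<open>\<not> h i (p j)\<close> makes the set connected.
  With \<open>j \<in> J\<close> the sets stay within the classes indexed by \<open>J\<close>, so
  sets built from the removed classes can be added disjointly.\<close>

lemma branch_sets_exist:
  assumes "J \<subseteq> I"
  shows "\<exists>F. (\<forall>i\<in>J. F i = {i} \<or> (\<exists>j\<in>J. p j \<noteq> j \<and> i \<noteq> j \<and> \<not> h i (p j) \<and> F i = {i, p j})) \<and>
    (\<forall>i\<in>J. \<forall>j\<in>J. i \<noteq> j \<longrightarrow> separated_adjacent (F i) (F j))"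
    (is "\<exists>F. ?shape F J \<and> ?compatible F J")
  using finite_subset[OF assms finite_I] assms
proof (induction J rule: finite_psubset_induct)
  case (psubset J)
  show ?case
  proof (cases "J = {}")
    case False
    then obtain s where s: "s \<in> J" and source: "\<And>j. j \<in> J \<Longrightarrow> j \<noteq> s \<Longrightarrow> \<not> h j (p s)"
      using source_exists[OF psubset.prems False] by blast
    define P where "P = {j \<in> J. h s j}"
    have mem: "i \<in> F i \<and> F i \<subseteq> K \<union> p ` K" if "?shape F K" "i \<in> K" for F i K
      using bspec[OF that] that(2) by auto
    show ?thesis
    proof (cases "P = {}")
      case True
      obtain F where F: "?shape F (J - {s})" "?compatible F (J - {s})"
        using psubset.IH[of "J - {s}"] psubset.prems s by blast
      let ?F = "F(s := {s})"
      have sh: "?shape ?F J"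
        using F(1) by auto
      have *: "separated_adjacent (?F s) (?F j)" if j: "j \<in> J" "j \<noteq> s" for j
      proof -
        have "j \<in> F j" "F j \<subseteq> (J - {s}) \<union> p ` (J - {s})"
          using mem[OF F(1), of j] j by auto
        moreover have "s \<notin> p ` (J - {s})"
          using s psubset.prems partner_distinct(3)[of _ s] by auto
        moreover have "\<not> h s j" using True j by (auto simp: P_def)
        ultimately show ?thesis using j by (auto simp: separated_adjacent_def)
      qed
      have "?compatible ?F J"
      proof (intro ballI impI)
        fix i j assume ij: "i \<in> J" "j \<in> J" "i \<noteq> j"
        consider "i = s" | "j = s" | "i \<noteq> s" "j \<noteq> s" by auto
        then show "separated_adjacent (?F i) (?F j)"
        proof cases
          case 1
          then show ?thesis using *[of j] ij by simp
        next
          case 2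
          then show ?thesis using separated_adjacent_sym[OF *[of i]] ij by simp
        next
          case 3
          then show ?thesis using F(2) ij by simp
        qed
      qed
      then show ?thesis using sh by blast
    next
      case False
      then obtain i where i: "i \<in> P" and min: "\<And>j. j \<in> P \<Longrightarrow> j \<noteq> i \<Longrightarrow> \<not> h j (p i)"
        using source_exists[of P] psubset.prems unfolding P_def by blast
      have iJ: "i \<in> J" "h s i" "i \<noteq> s" using i by (auto simp: P_def nonadjacent_def)
      have I: "i \<in> I" "s \<in> I" using iJ s psubset.prems by auto
      have ne: "p i \<noteq> i" "p s \<noteq> s"
        using I iJ singleton_class_not_nonadjacent nonadjacent_sym by blast+
      let ?K = "J - {s, i}"
      obtain F where F: "?shape F ?K" "?compatible F ?K"
        using psubset.IH[of ?K] psubset.prems s by blast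
      let ?F = "F(s := {s, p i}, i := {i, p s})"
      \<comment> \<open>Otherwise \<open>s\<close>, \<open>i\<close> and \<open>p i\<close> would
        form an antitriangle.\<close>
      have spi: "\<not> h s (p i)"
        using no_triangle[of s i "p i"] iJ ne I partner_nonadjacent by blast
      have ips: "\<not> h i (p s)"
        using source iJ by blast
      have sh: "?shape ?F J"
        using F(1) s iJ ne spi ips by auto
      have far: "{s, p i, i, p s} \<inter> F j = {}" "j \<in> F j" if j: "j \<in> ?K" for j
      proof -
        have sub: "j \<in> F j" "F j \<subseteq> ?K \<union> p ` ?K"
          using mem[OF F(1) j] by auto
        have "x \<notin> {s, p i, i, p s}" if x: "x \<in> p ` ?K" for x
        proof -
          obtain k where k: "x = p k" "k \<in> I" "k \<noteq> s" "k \<noteq> i"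
            using x psubset.prems by blast
          then show ?thesis
            using partner_distinct[OF k(2) I(1)] partner_distinct[OF k(2) I(2)] by simp
        qed
        moreover have "x \<notin> {s, p i, i, p s}" if "x \<in> ?K" for x
          using that psubset.prems partner_notin[OF I(1)] partner_notin[OF I(2)] ne by auto
        ultimately have "{s, p i, i, p s} \<inter> (?K \<union> p ` ?K) = {}"
          by (meson Un_iff disjoint_iff)
        then show "{s, p i, i, p s} \<inter> F j = {}" "j \<in> F j"
          using sub by blast+
      qed
      have with_s: "separated_adjacent (?F s) (?F j)" if j: "j \<in> ?K" for j
      proof -
        \<comment> \<open>Outside \<open>P\<close> the vertex \<open>j\<close> is adjacent to
          \<open>s\<close>; inside \<open>P\<close> it is adjacent to \<open>p i\<close>, because
          \<open>i\<close> is a source of \<open>P\<close>.\<close>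
        have "\<not> h s j \<or> \<not> h (p i) j"
          using min[of j] j by (auto simp: P_def dest: nonadjacent_sym)
        then show ?thesis using far[OF j] iJ j by (auto simp: separated_adjacent_def)
      qed
      have with_i: "separated_adjacent (?F i) (?F j)" if j: "j \<in> ?K" for j
      proof -
        \<comment> \<open>Here \<open>s\<close> being a source of all of \<open>J\<close>
          suffices.\<close>
        have "\<not> h (p s) j"
          using source[of j] j by (auto dest: nonadjacent_sym)
        then show ?thesis using far[OF j] j by (auto simp: separated_adjacent_def)
      qed
      have si: "separated_adjacent (?F s) (?F i)"
      proof -
        \<comment> \<open>The edge between the two new branch sets joins the partners, whose
          adjacency is forced by the non-edge between \<open>s\<close> and \<open>i\<close>.\<close>
        have "\<not> h (p i) (p s)"
          using partner_adjacent[OF I] iJ nonadjacent_sym by blast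
        then show ?thesis
          using iJ ne partner_distinct[OF I] by (auto simp: separated_adjacent_def)
      qed
      have "?compatible ?F J"
      proof (intro ballI impI)
        fix k l assume kl: "k \<in> J" "l \<in> J" "k \<noteq> l"
        consider "k = s" "l = i" | "k = i" "l = s" | "k = s" "l \<in> ?K" | "k = i" "l \<in> ?K"
          | "l = s" "k \<in> ?K" | "l = i" "k \<in> ?K" | "k \<in> ?K" "l \<in> ?K"
          using kl by blast
        then show "separated_adjacent (?F k) (?F l)"
        proof cases
          case 1
          then show ?thesis using si by simp
        next
          case 2
          then show ?thesis using separated_adjacent_sym[OF si] by simp
        next
          case 3
          then show ?thesis using with_s by simp
        next
          case 4
          then show ?thesis using with_i by simp
        next
          case 5
          then show ?thesis using separated_adjacent_sym[OF with_s] by simp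
        next
          case 6
          then show ?thesis using separated_adjacent_sym[OF with_i] by simp
        next
          case 7
          then show ?thesis using F(2) kl by simp
        qed
      qed
      then show ?thesis using sh by blast
    qed
  qed simp
qed

end

section \<open>From the given coloring to the partner map, and from the branch sets to the clique
  minor\<close>

theorem theorem4:
  fixes G :: "('a, 'b) pre_digraph" and C :: "'a set set" and T :: "'a set"
  assumes "graph G"
    and "\<not> (\<exists>S. antitriangle G S)"
    and "\<exists>!D. coloring G D \<and> card D = chromatic_number G"
    and "coloring G C" and "card C = chromatic_number G"
    and "transversal C T"
  shows "\<exists>K. clique_minor G K \<and> shallow K \<and> card K = chromatic_number G \<and> transversal K T"
proof -
  interpret graph G by fact
  \<comment> \<open>A transversal may contain points outside the graph; dropping them does not
    change its intersections with the color classes.\<close>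
  define I where "I = T \<inter> verts G"
  have part: "partition_on (verts G) C" and anti: "\<And>X. X \<in> C \<Longrightarrow> anticlique G X"
    using assms(4) by (auto simp: coloring_def)
  have CI: "card (I \<inter> X) = 1" "X \<subseteq> verts G" if "X \<in> C" for X
  proof -
    show sub: "X \<subseteq> verts G" using that part by (auto simp: partition_on_def)
    have "I \<inter> X = T \<inter> X" using sub by (auto simp: I_def)
    then show "card (I \<inter> X) = 1" using assms(6) that by (simp add: transversal_def)
  qed
  \<comment> \<open>For a singleton class the witness is \<open>i\<close> itself, whence the
    convention \<open>p i = i\<close>.\<close>
  have "\<exists>y. {i, y} \<in> C" if i: "i \<in> I" for i
  proof -
    obtain X where X: "X \<in> C" "i \<in> X"
      using i part by (auto simp: I_def partition_on_def)
    have "card X \<noteq> 0"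
      using X CI(2)[of X] finite_verts by (metis card_eq_0_iff empty_iff finite_subset)
    moreover have "\<not> 3 \<le> card X"
    proof
      assume "3 \<le> card X"
      then obtain S where "S \<subseteq> X" "card S = 3" by (meson obtain_subset_with_card_n)
      then have "antitriangle G S"
        using anti[OF X(1)] unfolding antitriangle_def anticlique_def
        by (meson pairwise_subset subset_trans)
      then show False using assms(2) by blast
    qed
    ultimately consider "card X = 1" | "card X = 2" by linarith
    then have "\<exists>y. X = {i, y}"
    proof cases
      case 1
      then show ?thesis using X by (auto simp: card_1_singleton_iff)
    next
      case 2
      then show ?thesis using X by (auto simp: card_2_iff insert_commute)
    qed
    then show ?thesis using X by blast
  qed
  then obtain p where p: "{i, p i} \<in> C" if "i \<in> I" for i by metis
  have only: "x = i" if X: "X \<in> C" and xi: "x \<in> X" "i \<in> X" "x \<in> I" "i \<in> I" for x i X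
  proof -
    obtain z where "I \<inter> X = {z}"
      using card_1_singletonE[OF CI(1)[OF X]] .
    then have "x \<in> {z}" "i \<in> {z}" using xi by blast+
    then show ?thesis by simp
  qed
  have same: "X = Y" if "X \<in> C" "Y \<in> C" "x \<in> X" "x \<in> Y" for x X Y
    using that part by (auto simp: partition_on_def disjoint_def)
  have C_eq: "C = (\<lambda>i. {i, p i}) ` I"
  proof
    show "C \<subseteq> (\<lambda>i. {i, p i}) ` I"
    proof
      fix X assume X: "X \<in> C"
      then obtain i where "I \<inter> X = {i}" using CI(1) by (auto simp: card_1_singleton_iff)
      then have "X = {i, p i}" "i \<in> I" using same[OF X p[of i], of i] by auto
      then show "X \<in> (\<lambda>i. {i, p i}) ` I" by auto
    qed
  qed (use p in auto)
  have finI: "finite I" using finite_verts by (simp add: I_def)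
  have injC: "inj_on (\<lambda>i. {i, p i}) I"
  proof (rule inj_onI)
    fix i j assume ij: "i \<in> I" "j \<in> I" "{i, p i} = {j, p j}"
    then have "i \<in> {j, p j}" by blast
    then show "i = j" using only[OF p[OF ij(2)]] ij(1,2) by blast
  qed
  have cardI: "card I = chromatic_number G"
    using card_image[OF injC] C_eq assms(5) by simp
  interpret rigid_partner G I p
  proof
    show "\<not> (\<exists>S. antitriangle G S)" by fact
    show "verts G = I \<union> p ` I"
      using part C_eq by (auto simp: partition_on_def)
    show "inj_on p I"
    proof (rule inj_onI)
      fix i j assume ij: "i \<in> I" "j \<in> I" "p i = p j"
      then have "{i, p i} = {j, p j}"
        using same[OF p[OF ij(1)] p[OF ij(2)], of "p i"] by simp
      then show "i = j" using injC ij(1,2) by (auto dest: inj_onD)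
    qed
    show "p i = i" if "i \<in> I" "p i \<in> I" for i
      using only[OF p[OF that(1)], of "p i" i] that by simp
    show "nonadjacent G i (p i)" if "i \<in> I" "p i \<noteq> i" for i
      using anti[OF p[OF that(1)]] that
      by (auto simp: anticlique_def nonadjacent_def pairwise_def)
  next
    fix F :: "'a \<Rightarrow> 'a set"
    assume F: "\<Union>(F ` I) = verts G"
      "\<And>s t. s \<in> I \<Longrightarrow> t \<in> I \<Longrightarrow> F s = F t \<or> F s \<inter> F t = {}"
      "\<And>s. s \<in> I \<Longrightarrow> F s \<noteq> {} \<and> anticlique G (F s)"
    have col: "coloring G (F ` I)"
      using F unfolding coloring_def partition_on_def disjoint_def by fastforce
    \<comment> \<open>The family has at most \<open>card I\<close> distinct members, and
      \<open>card I\<close> is the chromatic number. Minimality turns this into equality, after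
      which uniqueness applies.\<close>
    then have "chromatic_number G \<le> card (F ` I)"
      unfolding chromatic_number_def by (intro Least_le) blast
    then have "card (F ` I) = chromatic_number G"
      using card_image_le[OF finI, of F] cardI by simp
    moreover obtain D where "E = D" if "coloring G E \<and> card E = chromatic_number G" for E
      using assms(3) by (elim ex1E) blast
    ultimately have "F ` I = C"
      using col assms(4,5) by metis
    then show "F ` I = (\<lambda>s. {s, p s}) ` I"
      by (simp only: C_eq)
  qed
  obtain F where
    shape: "\<forall>i\<in>I. F i = {i} \<or> (\<exists>j\<in>I. p j \<noteq> j \<and> i \<noteq> j \<and> \<not> h i (p j) \<and> F i = {i, p j})"
    and compat: "\<forall>i\<in>I. \<forall>j\<in>I. i \<noteq> j \<longrightarrow> separated_adjacent (F i) (F j)"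
    using branch_sets_exist[OF subset_refl] by (elim exE conjE)
  have F: "i \<in> F i" "F i \<subseteq> verts G" "card (F i) = 1 \<or> card (F i) = 2" "F i \<inter> T = {i}"
    "connected_subset G (F i)" if i: "i \<in> I" for i
  proof -
    consider "F i = {i}" | j where "j \<in> I" "p j \<noteq> j" "i \<noteq> j" "\<not> h i (p j)" "F i = {i, p j}"
      using bspec[OF shape i] by (elim disjE bexE conjE)
    then have "i \<in> F i \<and> F i \<subseteq> verts G \<and> (card (F i) = 1 \<or> card (F i) = 2) \<and> F i \<inter> T = {i}
      \<and> connected_subset G (F i)"
    proof cases
      case 1
      then show ?thesis
        using i in_verts connected_subset_singleton by (auto simp: I_def)
    next
      case 2
      \<comment> \<open>If \<open>p j\<close> were in \<open>T\<close>, it would lie in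
        \<open>I\<close> and hence equal \<open>j\<close>. So \<open>i\<close> is the only element
        of \<open>T\<close> in the branch set.\<close>
      have "i \<noteq> p j" "p j \<notin> T" "p j \<in> verts G"
        using 2 i partner_distinct[of j i] partner_notin[of j] in_verts by (auto simp: I_def)
      moreover from this have "i \<rightarrow>\<^bsub>G\<^esub> p j"
        using 2 i in_verts by (auto simp: nonadjacent_def)
      ultimately show ?thesis
        using 2 i in_verts connected_subset_pair by (auto simp: I_def)
    qed
    then show "i \<in> F i" "F i \<subseteq> verts G" "card (F i) = 1 \<or> card (F i) = 2" "F i \<inter> T = {i}"
      "connected_subset G (F i)" by blast+
  qed
  have adj: "adjacent_subsets G (F i) (F j)" if ij: "i \<in> I" "j \<in> I" "i \<noteq> j" for i j
  proof -
    \<comment> \<open>Disjointness makes \<open>u\<close> and \<open>v\<close> distinct, so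
      \<open>\<not> h u v\<close> is a genuine edge.\<close>
    obtain u v where uv: "u \<in> F i" "v \<in> F j" "\<not> h u v" "F i \<inter> F j = {}"
      using compat ij unfolding separated_adjacent_def by metis
    then have "u \<rightarrow>\<^bsub>G\<^esub> v"
      using F(2) ij unfolding nonadjacent_def by blast
    then show ?thesis using uv unfolding adjacent_subsets_def by blast
  qed
  have disj: "F i \<inter> F j = {}" if "i \<in> I" "j \<in> I" "i \<noteq> j" for i j
    using compat that by (simp add: separated_adjacent_def)
  have "clique_minor G (F ` I)"
    unfolding clique_minor_def
  proof (intro conjI)
    show "\<forall>S\<in>F ` I. S \<noteq> {} \<and> connected_subset G S"
      using F(1,5) by auto
    show "disjoint (F ` I)"
      using disj unfolding disjoint_def by (metis imageE)
    show "pairwise (adjacent_subsets G) (F ` I)"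
      using adj unfolding pairwise_def by (metis imageE)
  qed
  moreover have "shallow (F ` I)"
    using F(3) by (auto simp: shallow_def)
  moreover have "card (F ` I) = chromatic_number G"
  proof -
    have "inj_on F I"
      using F(1) disj by (intro inj_onI) (metis IntI empty_iff)
    then show ?thesis using cardI by (simp add: card_image)
  qed
  moreover have "transversal (F ` I) T"
    using F(4) by (auto simp: transversal_def Int_commute)
  ultimately show ?thesis by blast
qed

end
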